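(* Let $\mathcal{A}:\mathcal{G}\to\mathcal{S}$ be a randomized algorithm for a graph problem whose solutions are subsets of the edge set of the input graph. Assume there is an oracle $\mathcal{O}$ such that (i) when given access to a graph $G=(V,E)$ and a query $e\in E$, $\mathcal{O}$ generates a random string $\pi\in\{0,1\}^{r(|V|)}$ and outputs whether $e$ is contained in the solution obtained by running $\mathcal{A}$ on $G$ with $\pi$ as its random string; and (ii) $\mathcal{O}$ makes at most $q(G)$ queries to $G$ in expectation, where the expectation is over the random coins of $\mathcal{A}$ and a uniformly random query $e\in E$. Then $\mathcal{A}$ has average sensitivity at most $q(G)$ at every graph $G$. Moreover, the same conclusion holds for graph problems whose solutions are subsets of the vertex set of the input graph, for graphs with $|E|\ge|V|$.
   Context: $\mathcal{G}$ is the set of finite undirected graphs; $G-e$ is $G$ with edge $e$ deleted. The average sensitivity of a randomized algorithm $\mathcal{A}$ at $G=(V,E)$ is $\mathbb{E}_{e\sim E}[d_{\mathrm{EM}}(\mathcal{A}(G),\mathcal{A}(G-e))]$, where $e$ is uniform in $E$, $\mathcal{A}(G)$ is the output distribution, and $d_{\mathrm{EM}}$ is the earth mover's distance with respect to the Hamming distance (size of symmetric difference) between solutions.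
   Formalization: The formal theorem assumes that the answer to each query to G can be changed by deleting at most one edge, and that the edge oracle also answers correctly (rejects) when given a vertex pair that is not an edge; without these the claim fails, e.g. A(G)=E with 0 queries. E is nonempty. *)

theory Defs
  imports "HOL-Probability.Probability"
begin

type_synonym 'v graph = "'v set \<times> 'v set set"

abbreviation verts :: "'v graph \<Rightarrow> 'v set" where "verts \<equiv> fst"
abbreviation edges :: "'v graph \<Rightarrow> 'v set set" where "edges \<equiv> snd"

definition vertex_pairs :: "'v set \<Rightarrow> 'v set set" where
  "vertex_pairs V = {e. e \<subseteq> V \<and> card e = 2}"

definition graphs :: "'v graph set" where
  "graphs = {G. finite (verts G) \<and> edges G \<subseteq> vertex_pairs (verts G)}"

definition delete_edge :: "'v graph \<Rightarrow> 'v set \<Rightarrow> 'v graph" where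
  "delete_edge G e = (verts G, edges G - {e})"


section \<open>Earth mover's distance and average sensitivity\<close>

definition hamming :: "'x set \<Rightarrow> 'x set \<Rightarrow> nat" where
  "hamming S T = card ((S - T) \<union> (T - S))"

definition couplings :: "'a pmf \<Rightarrow> 'b pmf \<Rightarrow> ('a \<times> 'b) pmf set" where
  "couplings p p' = {D. map_pmf fst D = p \<and> map_pmf snd D = p'}"

text \<open>All distributions to which this is applied have finite support and are supported on
  finite sets, so the expectation below is a finite sum.\<close>

definition earth_mover :: "'x set pmf \<Rightarrow> 'x set pmf \<Rightarrow> real" where
  "earth_mover p p' =
    (INF D\<in>couplings p p'. measure_pmf.expectation D (\<lambda>(S, T). real (hamming S T)))"

text \<open>Meaningful only if \<open>G\<close> has an edge.\<close>

definition average_sensitivity :: "('v graph \<Rightarrow> 'x set pmf) \<Rightarrow> 'v graph \<Rightarrow> real" where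
  "average_sensitivity D G =
    measure_pmf.expectation (pmf_of_set (edges G)) (\<lambda>e. earth_mover (D G) (D (delete_edge G e)))"


section \<open>Randomized algorithms\<close>

text \<open>A randomized algorithm is a function of the input graph and of a random string, which is
  uniform in \<open>{0,1}\<^bsup>r(n)\<^esup>\<close> for graphs with \<open>n\<close> vertices.\<close>

type_synonym ('v, 'x) algorithm = "'v graph \<Rightarrow> bool list \<Rightarrow> 'x set"

definition strings :: "(nat \<Rightarrow> nat) \<Rightarrow> 'v graph \<Rightarrow> bool list set" where
  "strings r G = {\<pi>. length \<pi> = r (card (verts G))}"

definition random_string :: "(nat \<Rightarrow> nat) \<Rightarrow> 'v graph \<Rightarrow> bool list pmf" where
  "random_string r G = pmf_of_set (strings r G)"

definition output_distribution ::
    "(nat \<Rightarrow> nat) \<Rightarrow> ('v, 'x) algorithm \<Rightarrow> 'v graph \<Rightarrow> 'x set pmf" where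
  "output_distribution r A G = map_pmf (A G) (random_string r G)"

definition edge_algorithm :: "(nat \<Rightarrow> nat) \<Rightarrow> ('v, 'v set) algorithm \<Rightarrow> bool" where
  "edge_algorithm r A \<longleftrightarrow> (\<forall>G\<in>graphs. \<forall>\<pi>\<in>strings r G. A G \<pi> \<subseteq> edges G)"

definition vertex_algorithm :: "(nat \<Rightarrow> nat) \<Rightarrow> ('v, 'v) algorithm \<Rightarrow> bool" where
  "vertex_algorithm r A \<longleftrightarrow> (\<forall>G\<in>graphs. \<forall>\<pi>\<in>strings r G. A G \<pi> \<subseteq> verts G)"


section \<open>Query access to a graph\<close>

text \<open>An access model says how each query is answered on each graph. A single query may only
  look at a single edge: at most one edge of a graph is such that deleting it changes the answer.
  This holds for adjacency queries and for walking along adjacency lists (see the two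
  lemmas below). It fails for degree queries, and for them bounding the sensitivity by the number
  of queries is impossible: whether a vertex has even degree is decided by one query, but
  every edge deletion changes this for two vertices.\<close>

definition single_edge_queries :: "('v graph \<Rightarrow> 'q \<Rightarrow> 'a) \<Rightarrow> bool" where
  "single_edge_queries ans \<longleftrightarrow>
    (\<forall>G\<in>graphs. \<forall>k. \<forall>e\<in>edges G. \<forall>e'\<in>edges G.
      ans (delete_edge G e) k \<noteq> ans G k \<and> ans (delete_edge G e') k \<noteq> ans G k \<longrightarrow> e = e')"

definition adjacency_query :: "'v graph \<Rightarrow> 'v \<times> 'v \<Rightarrow> bool" where
  "adjacency_query G = (\<lambda>(u, v). {u, v} \<in> edges G)"

lemma single_edge_queries_adjacency: "single_edge_queries adjacency_query"
  by (auto simp: single_edge_queries_def adjacency_query_def delete_edge_def)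

text \<open>The first neighbour of \<open>v\<close>, or the first one after \<open>w\<close>, if there is any.\<close>

definition next_neighbour :: "'v::linorder graph \<Rightarrow> 'v \<times> 'v option \<Rightarrow> 'v option" where
  "next_neighbour G = (\<lambda>(v, w).
    let N = {u. {v, u} \<in> edges G \<and> (case w of None \<Rightarrow> True | Some x \<Rightarrow> x < u)}
    in if N = {} then None else Some (Min N))"

lemma single_edge_queries_next_neighbour:
  "single_edge_queries (next_neighbour :: 'v::linorder graph \<Rightarrow> _)"
proof -
  have *: "e = {v, Min {u. {v, u} \<in> edges G \<and> (case w of None \<Rightarrow> True | Some x \<Rightarrow> x < u)}}"
    if G: "G \<in> graphs" and ne: "next_neighbour (delete_edge G e) (v, w) \<noteq> next_neighbour G (v, w)"
    for G :: "'v graph" and e v w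
  proof (rule ccontr)
    define above where "above = (\<lambda>u. case w of None \<Rightarrow> True | Some x \<Rightarrow> x < u)"
    define N where "N = {u. {v, u} \<in> edges G \<and> above u}"
    define N' where "N' = {u. {v, u} \<in> edges G - {e} \<and> above u}"
    assume "e \<noteq> {v, Min {u. {v, u} \<in> edges G \<and> (case w of None \<Rightarrow> True | Some x \<Rightarrow> x < u)}}"
    then have e: "e \<noteq> {v, Min N}" by (simp add: N_def above_def)
    have fin: "finite N"
      by (rule finite_subset[of _ "verts G"]) (use G in \<open>auto simp: N_def graphs_def vertex_pairs_def\<close>)
    have sub: "N' \<subseteq> N" by (auto simp: N_def N'_def)
    have ne': "(if N' = {} then None else Some (Min N')) \<noteq> (if N = {} then None else Some (Min N))"
      using ne by (simp only: next_neighbour_def delete_edge_def N_def N'_def above_def Let_def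
          prod.case snd_conv not_False_eq_True)
    then have "N \<noteq> {}" using sub by auto
    then have "Min N \<in> N" using fin by simp
    then have mem: "Min N \<in> N'" using e by (auto simp: N_def N'_def)
    moreover have "Min N' = Min N"
      using fin sub mem by (intro Min_eqI) (auto intro: finite_subset)
    ultimately show False using ne' \<open>N \<noteq> {}\<close> by (metis empty_iff)
  qed
  show ?thesis
    unfolding single_edge_queries_def
  proof (intro ballI allI impI, elim conjE)
    fix G :: "'v graph" and k e e'
    assume G: "G \<in> graphs" and "next_neighbour (delete_edge G e) k \<noteq> next_neighbour G k"
      and "next_neighbour (delete_edge G e') k \<noteq> next_neighbour G k"
    moreover obtain v w where "k = (v, w)" by fastforce
    ultimately show "e = e'"
      using *[OF G, of e v w] *[OF G, of e' v w] by argo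
  qed
qed

text \<open>Adaptive query strategies with a Boolean result.\<close>

datatype ('q, 'a) strategy = Answer bool | Ask 'q "'a \<Rightarrow> ('q, 'a) strategy"

primrec run :: "('q \<Rightarrow> 'a) \<Rightarrow> ('q, 'a) strategy \<Rightarrow> bool" where
  "run f (Answer b) = b"
| "run f (Ask k c) = run f (c (f k))"

primrec num_queries :: "('q \<Rightarrow> 'a) \<Rightarrow> ('q, 'a) strategy \<Rightarrow> nat" where
  "num_queries f (Answer b) = 0"
| "num_queries f (Ask k c) = Suc (num_queries f (c (f k)))"


section \<open>Local oracles for an algorithm\<close>

text \<open>The strategy depends on the vertex set, on the random string and on the element whose
  membership is asked for; the edge set is accessible through queries only.\<close>

type_synonym ('v, 'x, 'q, 'a) local_oracle = "'v set \<Rightarrow> bool list \<Rightarrow> 'x \<Rightarrow> ('q, 'a) strategy"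

text \<open>The oracle is correct on all vertex pairs, so it rejects a pair that is not an edge:
  it must not learn for free that the pair it is given is an edge. Otherwise the algorithm that
  outputs all edges, whose average sensitivity is 1, would need no queries.\<close>

definition edge_oracle :: "('v graph \<Rightarrow> 'q \<Rightarrow> 'a) \<Rightarrow> (nat \<Rightarrow> nat) \<Rightarrow>
    ('v, 'v set) algorithm \<Rightarrow> ('v, 'v set, 'q, 'a) local_oracle \<Rightarrow> bool" where
  "edge_oracle ans r A Orc \<longleftrightarrow>
    (\<forall>G\<in>graphs. \<forall>\<pi>\<in>strings r G. \<forall>e\<in>vertex_pairs (verts G).
      run (ans G) (Orc (verts G) \<pi> e) \<longleftrightarrow> e \<in> A G \<pi>)"

definition vertex_oracle :: "('v graph \<Rightarrow> 'q \<Rightarrow> 'a) \<Rightarrow> (nat \<Rightarrow> nat) \<Rightarrow>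
    ('v, 'v) algorithm \<Rightarrow> ('v, 'v, 'q, 'a) local_oracle \<Rightarrow> bool" where
  "vertex_oracle ans r A Orc \<longleftrightarrow>
    (\<forall>G\<in>graphs. \<forall>\<pi>\<in>strings r G. \<forall>v\<in>verts G.
      run (ans G) (Orc (verts G) \<pi> v) \<longleftrightarrow> v \<in> A G \<pi>)"

text \<open>\<open>X\<close> is the finite nonempty set from which the element asked for is drawn.\<close>

definition expected_queries :: "('v graph \<Rightarrow> 'q \<Rightarrow> 'a) \<Rightarrow> (nat \<Rightarrow> nat) \<Rightarrow>
    ('v, 'x, 'q, 'a) local_oracle \<Rightarrow> 'v graph \<Rightarrow> 'x set \<Rightarrow> real" where
  "expected_queries ans r Orc G X =
    measure_pmf.expectation (pair_pmf (random_string r G) (pmf_of_set X))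
      (\<lambda>(\<pi>, x). real (num_queries (ans G) (Orc (verts G) \<pi> x)))"

end

theory Submission
  imports Defs
begin

text \<open>Couple the runs on \<open>G\<close> and on \<open>G - e\<close> by using the same random string. The membership of
  \<open>x\<close> in the two outputs can only differ if some query made by the oracle on \<open>G\<close> is answered
  differently on \<open>G - e\<close>, and each query made on \<open>G\<close> accounts for at most one edge \<open>e\<close>. So for
  every string and every \<open>x\<close>, the number of edges \<open>e\<close> that affect \<open>x\<close> is at most the number of
  queries; double counting over \<open>e\<close> and \<open>x\<close> gives the claim.\<close>

lemma earth_mover_map_pmf_le:
  "earth_mover (map_pmf f p) (map_pmf g p)
     \<le> measure_pmf.expectation p (\<lambda>\<pi>. real (hamming (f \<pi>) (g \<pi>)))"
proof -
  define D where "D = map_pmf (\<lambda>\<pi>. (f \<pi>, g \<pi>)) p"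
  have "D \<in> couplings (map_pmf f p) (map_pmf g p)"
    by (simp add: D_def couplings_def pmf.map_comp comp_def)
  \<comment> \<open>\<open>D\<close> is the coupling that feeds one common sample to both functions.
    An infimum of reals lies below each member only if the family is bounded below; here 0 is a
    bound, since every cost is nonnegative.\<close>
  then have "earth_mover (map_pmf f p) (map_pmf g p)
      \<le> measure_pmf.expectation D (\<lambda>(S, T). real (hamming S T))"
    unfolding earth_mover_def
    by (intro cINF_lower bdd_belowI2[where m = 0] integral_nonneg_AE) auto
  then show ?thesis
    by (simp add: D_def)
qed

text \<open>Induction on the strategy: the first query pays for the at most one \<open>e\<close>
  that changes its answer. Every other \<open>e\<close> leads into the same subtree as
  \<open>f\<close>, so only queries made under \<open>f\<close> are charged.\<close>

lemma card_run_neq_le_num_queries: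
  assumes "finite E"
    and single: "\<And>k e e'. e \<in> E \<Longrightarrow> e' \<in> E \<Longrightarrow> g e k \<noteq> f k \<Longrightarrow> g e' k \<noteq> f k \<Longrightarrow> e = e'"
  shows "card {e \<in> E. run (g e) t \<noteq> run f t} \<le> num_queries f t"
proof (induction t)
  case (Ask k c)
  let ?K = "{e \<in> E. g e k \<noteq> f k}" and ?R = "{e \<in> E. run (g e) (c (f k)) \<noteq> run f (c (f k))}"
  have "card ?K \<le> 1"
    using assms by (auto simp: card_le_Suc0_iff_eq)
  moreover have "card ?R \<le> num_queries f (c (f k))"
    using Ask by auto
  \<comment> \<open>If \<open>g e k = f k\<close>, both runs continue with \<open>c (f k)\<close>,
    so a difference in the results already occurs there.\<close>
  moreover have "card {e \<in> E. run (g e) (Ask k c) \<noteq> run f (Ask k c)} \<le> card (?K \<union> ?R)"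
    using \<open>finite E\<close> by (intro card_mono) auto
  moreover have "card (?K \<union> ?R) \<le> card ?K + card ?R"
    by (rule card_Un_le)
  ultimately show ?case
    by simp
qed simp

lemma finite_strings: "finite (strings r G)"
  using finite_lists_length_eq[of "UNIV :: bool set"] by (simp add: strings_def)

lemma strings_nonempty: "strings r G \<noteq> {}"
  using Ex_list_of_length[of "r (card (verts G))"] by (auto simp: strings_def)

text \<open>Deleting an edge keeps the vertex set, hence the length of the random string. This is
  what allows the runs on both graphs to share a string.\<close>

lemma strings_delete_edge: "strings r (delete_edge G e) = strings r G"
  by (simp add: strings_def delete_edge_def)

lemma delete_edge_in_graphs: "G \<in> graphs \<Longrightarrow> delete_edge G e \<in> graphs"
  by (auto simp: graphs_def delete_edge_def)

lemma finite_vertex_pairs: "finite V \<Longrightarrow> finite (vertex_pairs V)"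
  by (simp add: vertex_pairs_def)

lemma finite_edges: "G \<in> graphs \<Longrightarrow> finite (edges G)"
  by (auto simp: graphs_def intro: finite_subset finite_vertex_pairs)

lemma expectation_pair_pmf_of_set:
  fixes f :: "'a \<times> 'b \<Rightarrow> real"
  assumes "finite S" "S \<noteq> {}" "finite X" "X \<noteq> {}"
  shows "measure_pmf.expectation (pair_pmf (pmf_of_set S) (pmf_of_set X)) f
    = (\<Sum>\<pi>\<in>S. \<Sum>x\<in>X. f (\<pi>, x)) / (real (card S) * real (card X))"
proof -
  have "pair_pmf (pmf_of_set S) (pmf_of_set X) = pmf_of_set (S \<times> X)"
    using assms by (intro pmf_eqI)
      (simp add: pmf_pair indicator_def card_cartesian_product split_paired_all)
  then show ?thesis
    using assms by (simp add: integral_pmf_of_set card_cartesian_product sum.cartesian_product)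
qed

text \<open>Common core of the edge and the vertex case: \<open>X\<close> is a ground set that stays
  fixed under deletions and contains the outputs on \<open>G\<close> and on all
  \<open>delete_edge G e\<close>.\<close>

lemma average_sensitivity_le_expected_queries:
  fixes ans :: "'v graph \<Rightarrow> 'q \<Rightarrow> 'a" and A :: "('v, 'x) algorithm"
  assumes single: "single_edge_queries ans"
    and G: "G \<in> graphs" "edges G \<noteq> {}"
    and X: "finite X" "X \<noteq> {}" "card X \<le> card (edges G)"
    and subset: "\<And>\<pi>. \<pi> \<in> strings r G \<Longrightarrow> A G \<pi> \<subseteq> X"
    and subset': "\<And>e \<pi>. e \<in> edges G \<Longrightarrow> \<pi> \<in> strings r G \<Longrightarrow> A (delete_edge G e) \<pi> \<subseteq> X"
    and correct: "\<And>\<pi> x. \<pi> \<in> strings r G \<Longrightarrow> x \<in> X \<Longrightarrow>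
      run (ans G) (Orc (verts G) \<pi> x) \<longleftrightarrow> x \<in> A G \<pi>"
    and correct': "\<And>e \<pi> x. e \<in> edges G \<Longrightarrow> \<pi> \<in> strings r G \<Longrightarrow> x \<in> X \<Longrightarrow>
      run (ans (delete_edge G e)) (Orc (verts G) \<pi> x) \<longleftrightarrow> x \<in> A (delete_edge G e) \<pi>"
  shows "average_sensitivity (output_distribution r A) G \<le> expected_queries ans r Orc G X"
proof -
  let ?S = "strings r G" and ?E = "edges G"
  define differ where "differ = (\<lambda>\<pi> e x. (x \<in> A (delete_edge G e) \<pi>) \<noteq> (x \<in> A G \<pi>))"
  define Q where "Q = (\<Sum>\<pi>\<in>?S. \<Sum>x\<in>X. real (num_queries (ans G) (Orc (verts G) \<pi> x)))"
  have fin: "finite ?E"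
    using G(1) by (rule finite_edges)
  have pos: "card ?S > 0" "card ?E > 0" "card X > 0"
    using fin G(2) X by (simp_all add: card_gt_0_iff finite_strings strings_nonempty)
  have hamming: "hamming (A G \<pi>) (A (delete_edge G e) \<pi>) = card {x \<in> X. differ \<pi> e x}"
    if "e \<in> ?E" "\<pi> \<in> ?S" for e \<pi>
    unfolding hamming_def differ_def
    using subset[OF that(2)] subset'[OF that] by (intro arg_cong[where f = card]) auto
  have queries: "card {e \<in> ?E. differ \<pi> e x} \<le> num_queries (ans G) (Orc (verts G) \<pi> x)"
    if "\<pi> \<in> ?S" "x \<in> X" for \<pi> x
  proof -
    \<comment> \<open>The oracle sees the edge set through queries only, so the same strategy runs
      on both graphs and only the answers can differ.\<close>
    have "{e \<in> ?E. differ \<pi> e x} = {e \<in> ?E. run (ans (delete_edge G e)) (Orc (verts G) \<pi> x)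
        \<noteq> run (ans G) (Orc (verts G) \<pi> x)}"
      using that correct correct' by (auto simp: differ_def)
    then show ?thesis
      using card_run_neq_le_num_queries[OF fin, of "\<lambda>e. ans (delete_edge G e)" "ans G"] single G(1)
      by (fastforce simp: single_edge_queries_def)
  qed
  \<comment> \<open>Both sides count the pairs of \<open>e\<close> and \<open>x\<close> with
    \<open>differ \<pi> e x\<close>.\<close>
  have swap: "(\<Sum>e\<in>?E. card {x \<in> X. differ \<pi> e x}) = (\<Sum>x\<in>X. card {e \<in> ?E. differ \<pi> e x})" for \<pi>
    using sum.swap_restrict[OF fin X(1), of "\<lambda>_ _. 1::nat" "differ \<pi>"] by simp
  have earth_mover: "earth_mover (output_distribution r A G) (output_distribution r A (delete_edge G e))
      \<le> (\<Sum>\<pi>\<in>?S. real (card {x \<in> X. differ \<pi> e x})) / real (card ?S)" if "e \<in> ?E" for e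
    using earth_mover_map_pmf_le[of "A G" "pmf_of_set ?S" "A (delete_edge G e)"] that
    by (simp add: output_distribution_def random_string_def strings_delete_edge
        integral_pmf_of_set finite_strings strings_nonempty hamming)
  have "average_sensitivity (output_distribution r A) G
      \<le> (\<Sum>e\<in>?E. (\<Sum>\<pi>\<in>?S. real (card {x \<in> X. differ \<pi> e x})) / real (card ?S)) / real (card ?E)"
    unfolding average_sensitivity_def integral_pmf_of_set[OF G(2) fin]
    by (intro divide_right_mono sum_mono earth_mover) auto
  also have "\<dots> = (\<Sum>\<pi>\<in>?S. \<Sum>e\<in>?E. real (card {x \<in> X. differ \<pi> e x})) / (real (card ?S) * real (card ?E))"
    by (subst sum.swap) (simp add: sum_divide_distrib)
  also have "\<dots> = (\<Sum>\<pi>\<in>?S. \<Sum>x\<in>X. real (card {e \<in> ?E. differ \<pi> e x})) / (real (card ?S) * real (card ?E))"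
    using swap by (simp flip: of_nat_sum)
  also have "\<dots> \<le> Q / (real (card ?S) * real (card ?E))"
    unfolding Q_def using queries by (intro divide_right_mono sum_mono) auto
  \<comment> \<open>The left side averages over edges, the query bound over \<open>X\<close>. As
    \<open>Q\<close> is nonnegative, passing to the smaller denominator is where
    \<open>card X \<le> card (edges G)\<close> enters.\<close>
  also have "\<dots> \<le> Q / (real (card ?S) * real (card X))"
    using pos X(3) by (intro divide_left_mono mult_left_mono) (auto simp: Q_def intro!: sum_nonneg)
  also have "\<dots> = expected_queries ans r Orc G X"
    using X by (simp add: expected_queries_def random_string_def Q_def
        expectation_pair_pmf_of_set finite_strings strings_nonempty)
  finally show ?thesis .
qed

theorem mainTheorem4:
  fixes ans :: "'v graph \<Rightarrow> 'q \<Rightarrow> 'a"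
    and r :: "nat \<Rightarrow> nat"
    and q :: "'v graph \<Rightarrow> real"
    and A\<^sub>E :: "('v, 'v set) algorithm"
    and Orc\<^sub>E :: "('v, 'v set, 'q, 'a) local_oracle"
    and A\<^sub>V :: "('v, 'v) algorithm"
    and Orc\<^sub>V :: "('v, 'v, 'q, 'a) local_oracle"
  assumes "single_edge_queries ans"
  shows "(edge_algorithm r A\<^sub>E \<and> edge_oracle ans r A\<^sub>E Orc\<^sub>E \<and>
            (\<forall>G\<in>graphs. edges G \<noteq> {} \<longrightarrow> expected_queries ans r Orc\<^sub>E G (edges G) \<le> q G)
          \<longrightarrow> (\<forall>G\<in>graphs. edges G \<noteq> {} \<longrightarrow>
                 average_sensitivity (output_distribution r A\<^sub>E) G \<le> q G))
       \<and> (vertex_algorithm r A\<^sub>V \<and> vertex_oracle ans r A\<^sub>V Orc\<^sub>V \<and>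
            (\<forall>G\<in>graphs. verts G \<noteq> {} \<longrightarrow> expected_queries ans r Orc\<^sub>V G (verts G) \<le> q G)
          \<longrightarrow> (\<forall>G\<in>graphs. edges G \<noteq> {} \<and> card (verts G) \<le> card (edges G) \<longrightarrow>
                 average_sensitivity (output_distribution r A\<^sub>V) G \<le> q G))"
proof (intro conjI impI ballI; elim conjE)
  fix G :: "'v graph"
  assume alg: "edge_algorithm r A\<^sub>E" and orc: "edge_oracle ans r A\<^sub>E Orc\<^sub>E"
    and q: "\<forall>G\<in>graphs. edges G \<noteq> {} \<longrightarrow> expected_queries ans r Orc\<^sub>E G (edges G) \<le> q G"
    and G: "G \<in> graphs" "edges G \<noteq> {}"
  have H: "delete_edge G e \<in> graphs" "verts (delete_edge G e) = verts G"
    "edges (delete_edge G e) \<subseteq> edges G" for e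
    using delete_edge_in_graphs[OF G(1)] by (auto simp: delete_edge_def)
  have pairs: "edges G \<subseteq> vertex_pairs (verts G)"
    using G(1) by (simp add: graphs_def)
  have "average_sensitivity (output_distribution r A\<^sub>E) G \<le> expected_queries ans r Orc\<^sub>E G (edges G)"
  proof (rule average_sensitivity_le_expected_queries[OF assms G finite_edges[OF G(1)] G(2) order.refl])
    show "A\<^sub>E G \<pi> \<subseteq> edges G" if "\<pi> \<in> strings r G" for \<pi>
      using alg G(1) that by (simp add: edge_algorithm_def)
    show "A\<^sub>E (delete_edge G e) \<pi> \<subseteq> edges G" if "\<pi> \<in> strings r G" for e \<pi>
      using alg H that strings_delete_edge unfolding edge_algorithm_def by blast
    show "run (ans G) (Orc\<^sub>E (verts G) \<pi> x) \<longleftrightarrow> x \<in> A\<^sub>E G \<pi>" if "\<pi> \<in> strings r G" "x \<in> edges G" for \<pi> x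
      using orc G(1) that pairs unfolding edge_oracle_def by blast
    \<comment> \<open>Here \<open>x\<close> may be the deleted edge itself, no longer an edge of
      \<open>delete_edge G e\<close>. Correctness of the oracle on all vertex pairs covers this
      case.\<close>
    show "run (ans (delete_edge G e)) (Orc\<^sub>E (verts G) \<pi> x) \<longleftrightarrow> x \<in> A\<^sub>E (delete_edge G e) \<pi>"
      if "\<pi> \<in> strings r G" "x \<in> edges G" for e \<pi> x
      using orc H[of e] that pairs strings_delete_edge[of r G e] unfolding edge_oracle_def
      by (metis subsetD)
  qed
  then show "average_sensitivity (output_distribution r A\<^sub>E) G \<le> q G"
    using q G by fastforce
next
  fix G :: "'v graph"
  assume alg: "vertex_algorithm r A\<^sub>V" and orc: "vertex_oracle ans r A\<^sub>V Orc\<^sub>V"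
    and q: "\<forall>G\<in>graphs. verts G \<noteq> {} \<longrightarrow> expected_queries ans r Orc\<^sub>V G (verts G) \<le> q G"
    and G: "G \<in> graphs" "edges G \<noteq> {}" and card: "card (verts G) \<le> card (edges G)"
  have H: "delete_edge G e \<in> graphs" "verts (delete_edge G e) = verts G" for e
    using delete_edge_in_graphs[OF G(1)] by (auto simp: delete_edge_def)
  \<comment> \<open>An edge has two endpoints, so a graph with an edge has a vertex, and a uniformly
    random vertex query makes sense.\<close>
  have V: "finite (verts G)" "verts G \<noteq> {}"
    using G by (auto simp: graphs_def vertex_pairs_def)
  have "average_sensitivity (output_distribution r A\<^sub>V) G \<le> expected_queries ans r Orc\<^sub>V G (verts G)"
  proof (rule average_sensitivity_le_expected_queries[OF assms G V card])
    show "A\<^sub>V G \<pi> \<subseteq> verts G" if "\<pi> \<in> strings r G" for \<pi>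
      using alg G(1) that by (simp add: vertex_algorithm_def)
    show "A\<^sub>V (delete_edge G e) \<pi> \<subseteq> verts G" if "\<pi> \<in> strings r G" for e \<pi>
      using alg H[of e] that strings_delete_edge[of r G e] unfolding vertex_algorithm_def by metis
    show "run (ans G) (Orc\<^sub>V (verts G) \<pi> x) \<longleftrightarrow> x \<in> A\<^sub>V G \<pi>" if "\<pi> \<in> strings r G" "x \<in> verts G" for \<pi> x
      using orc G(1) that unfolding vertex_oracle_def by blast
    show "run (ans (delete_edge G e)) (Orc\<^sub>V (verts G) \<pi> x) \<longleftrightarrow> x \<in> A\<^sub>V (delete_edge G e) \<pi>"
      if "\<pi> \<in> strings r G" "x \<in> verts G" for e \<pi> x
      using orc H[of e] that strings_delete_edge[of r G e] unfolding vertex_oracle_def by metis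
  qed
  then show "average_sensitivity (output_distribution r A\<^sub>V) G \<le> q G"
    using q G V(2) by fastforce
qed

end
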